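(* The function $\beta:\mathbb{N}\to\mathbb{R}$ defined by $\beta(1)=0$ and, for $p>1$, $\beta(p)=\operatorname{tr}\big(Z\sum_{s=1}^{p-1}Y(s)\big)$ with $Y(s)=\sum_{r=0}^{s-1}A^rW(A^\top)^r$, is convex, i.e. $$\beta(i)\le\frac{\beta(i+1)+\beta(i-1)}{2}\qquad\text{for all } i\in\mathbb{N}\setminus\{1\}.$$
   Context: $A\in\mathbb{R}^{n_x\times n_x}$, $B\in\mathbb{R}^{n_x\times n_u}$, $Q=C_2^\top C_2$ with $(A,B)$ controllable and $(A,C_2)$ observable, $R$ symmetric with $R>0$, and $W\in\mathbb{R}^{n_x\times n_x}$ symmetric with $W\ge 0$. $P$ is the unique positive definite solution of $P=A^\top PA+Q-A^\top PB(R+B^\top PB)^{-1}B^\top PA$, and $Z=A^\top PB(B^\top PB+R)^{-1}B^\top PA$. Here $\mathbb{N}=\{1,2,\dots\}$. *)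

theory Defs
  imports "HOL-Analysis.Analysis"
begin

text \<open>
  On \<open>real ^ 'n ^ 'n\<close> the class operations \<open>*\<close> and \<open>^\<close> do not denote matrix product and
  matrix power, so powers with respect to \<open>**\<close> are introduced separately.
\<close>

primrec mpow :: "real ^ 'n ^ 'n \<Rightarrow> nat \<Rightarrow> real ^ 'n ^ 'n" where
  "mpow A 0 = mat 1"
| "mpow A (Suc k) = A ** mpow A k"

definition pos_semidef :: "real ^ 'n ^ 'n \<Rightarrow> bool" where
  "pos_semidef M \<longleftrightarrow> transpose M = M \<and> (\<forall>x. x \<bullet> (M *v x) \<ge> 0)"

definition pos_def :: "real ^ 'n ^ 'n \<Rightarrow> bool" where
  "pos_def M \<longleftrightarrow> transpose M = M \<and> (\<forall>x. x \<noteq> 0 \<longrightarrow> x \<bullet> (M *v x) > 0)"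

primrec trajectory ::
  "real ^ 'n ^ 'n \<Rightarrow> real ^ 'm ^ 'n \<Rightarrow> (nat \<Rightarrow> real ^ 'm) \<Rightarrow> real ^ 'n \<Rightarrow> nat \<Rightarrow> real ^ 'n"
where
  "trajectory A B u x 0 = x"
| "trajectory A B u x (Suc k) = A *v trajectory A B u x k + B *v u k"

text \<open>
  Any state can be steered to any other state in finite time. The target is arbitrary: steering
  to the origin only is a weaker property when \<open>A\<close> is singular.
\<close>

definition controllable :: "real ^ 'n ^ 'n \<Rightarrow> real ^ 'm ^ 'n \<Rightarrow> bool" where
  "controllable A B \<longleftrightarrow> (\<forall>x y. \<exists>N u. trajectory A B u x N = y)"

text \<open>The output sequence of the system without input determines the initial state.\<close>

definition observable :: "real ^ 'n ^ 'n \<Rightarrow> real ^ 'n ^ 'q \<Rightarrow> bool" where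
  "observable A C \<longleftrightarrow>
     (\<forall>x y. (\<forall>k. C *v (mpow A k *v x) = C *v (mpow A k *v y)) \<longrightarrow> x = y)"

text \<open>
  \<open>matrix_inv\<close> is meaningful below: \<open>R + B\<^sup>T P B\<close> is positive definite, hence invertible,
  for positive definite \<open>R\<close> and \<open>P\<close>.
\<close>

definition riccati_solution ::
  "real ^ 'n ^ 'n \<Rightarrow> real ^ 'm ^ 'n \<Rightarrow> real ^ 'n ^ 'n \<Rightarrow> real ^ 'm ^ 'm \<Rightarrow> real ^ 'n ^ 'n \<Rightarrow> bool"
where
  "riccati_solution A B Q R P \<longleftrightarrow>
     P = transpose A ** P ** A + Q
         - transpose A ** P ** B ** matrix_inv (R + transpose B ** P ** B)
           ** transpose B ** P ** A"

definition Z_mat ::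
  "real ^ 'n ^ 'n \<Rightarrow> real ^ 'm ^ 'n \<Rightarrow> real ^ 'm ^ 'm \<Rightarrow> real ^ 'n ^ 'n \<Rightarrow> real ^ 'n ^ 'n"
where
  "Z_mat A B R P =
     transpose A ** P ** B ** matrix_inv (transpose B ** P ** B + R)
       ** transpose B ** P ** A"

definition Y_mat :: "real ^ 'n ^ 'n \<Rightarrow> real ^ 'n ^ 'n \<Rightarrow> nat \<Rightarrow> real ^ 'n ^ 'n" where
  "Y_mat A W s = (\<Sum>r = 0..<s. mpow A r ** W ** mpow (transpose A) r)"

text \<open>Only the values at \<open>p \<ge> 1\<close> are meaningful.\<close>

definition \<beta> ::
  "real ^ 'n ^ 'n \<Rightarrow> real ^ 'n ^ 'n \<Rightarrow> real ^ 'n ^ 'n \<Rightarrow> nat \<Rightarrow> real"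
where
  "\<beta> A W Z p = (if p = 1 then 0 else trace (Z ** (\<Sum>s = 1..p - 1. Y_mat A W s)))"

end

theory Submission
  imports Defs
begin

text \<open>
  The second difference of \<open>\<beta>\<close> at \<open>i\<close> is the trace of \<open>Z X\<close> with
  \<open>X = A\<^sup>i\<^sup>-\<^sup>1 W (A\<^sup>T)\<^sup>i\<^sup>-\<^sup>1\<close>. Both factors are positive semidefinite, and then the trace is nonnegative,
  because \<open>X\<close> is a sum of matrices \<open>v v\<^sup>T\<close> with nonnegative weights and \<open>Z v v\<^sup>T\<close> has trace
  \<open>v \<bullet> Z v\<close>. Cholesky elimination provides the decomposition of \<open>X\<close> without the spectral theorem.
\<close>

lemma inner_transpose_mult:
  fixes S :: "real ^ 'm ^ 'n"
  shows "x \<bullet> (transpose S *v y) = (S *v x) \<bullet> y"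
  by (metis dot_lmul_matrix vector_transpose_matrix)

text \<open>Along the line \<open>x + t *\<^sub>R y\<close> the quadratic form is a polynomial in
  \<open>t\<close> of degree at most two that is nowhere negative, so its discriminant cannot be
  positive.\<close>

lemma pos_semidef_Cauchy_Schwarz:
  fixes X :: "real ^ 'n ^ 'n"
  assumes "pos_semidef X"
  shows "(x \<bullet> (X *v y))\<^sup>2 \<le> (x \<bullet> (X *v x)) * (y \<bullet> (X *v y))"
proof -
  define a b c where "a = x \<bullet> (X *v x)" and "b = x \<bullet> (X *v y)" and "c = y \<bullet> (X *v y)"
  have "y \<bullet> (X *v x) = b"
    using assms unfolding b_def pos_semidef_def
    by (metis inner_commute inner_transpose_mult)
  then have "(x + t *\<^sub>R y) \<bullet> (X *v (x + t *\<^sub>R y)) = a + 2 * t * b + t\<^sup>2 * c" for t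
    by (simp add: a_def b_def c_def matrix_vector_right_distrib matrix_vector_mult_scaleR
        inner_add_left inner_add_right power2_eq_square algebra_simps)
  then have q: "0 \<le> a + 2 * t * b + t\<^sup>2 * c" for t
    using assms unfolding pos_semidef_def by metis
  have "c \<ge> 0"
    using assms unfolding pos_semidef_def c_def by blast
  have "b\<^sup>2 \<le> a * c"
  proof (cases "c = 0")
    case True
    have "b = 0"
    proof (rule ccontr)
      assume "b \<noteq> 0"
      then show False
        \<comment> \<open>With \<open>c = 0\<close> the polynomial is affine in \<open>t\<close>;
          this \<open>t\<close> gives it the value -1.\<close>
        using q[of "- (a + 1) / (2 * b)"] True by (simp add: field_simps)
    qed
    then show ?thesis using True by simp
  next
    case False
    then show ?thesis
      \<comment> \<open>The minimiser of the polynomial, where its value is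
        \<open>a - b\<^sup>2 / c\<close>.\<close>
      using q[of "- b / c"] \<open>c \<ge> 0\<close> by (simp add: field_simps power2_eq_square)
  qed
  then show ?thesis by (simp add: a_def b_def c_def)
qed

lemma pos_semidef_congruence:
  fixes W :: "real ^ 'n ^ 'n"
  assumes "pos_semidef W"
  shows "pos_semidef (S ** W ** transpose S)"
proof -
  have "x \<bullet> ((S ** W ** transpose S) *v x) = (transpose S *v x) \<bullet> (W *v (transpose S *v x))" for x
    by (simp add: matrix_vector_mul_assoc[symmetric] dot_lmul_matrix[symmetric])
  then show ?thesis
    using assms by (simp add: pos_semidef_def matrix_transpose_mul matrix_mul_assoc)
qed

text \<open>One Cholesky step: \<open>X'\<close> is \<open>X\<close> minus
  \<open>v v\<^sup>T / X $ i $ i\<close>, where \<open>v\<close> is column \<open>i\<close> of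
  \<open>X\<close>. Cauchy-Schwarz for \<open>x\<close> and the \<open>i\<close>-th unit vector says
  exactly that the form stays nonnegative.\<close>

lemma pos_semidef_eliminate:
  fixes X :: "real ^ 'n ^ 'n"
  assumes X: "pos_semidef X" and i: "X $ i $ i \<noteq> 0"
  defines "X' \<equiv> \<chi> j k. X $ j $ k - X $ j $ i * X $ k $ i / X $ i $ i"
  shows "pos_semidef X'"
proof -
  have sym: "X $ j $ k = X $ k $ j" for j k
    using X unfolding pos_semidef_def by (metis transpose_def vec_lambda_beta)
  have form: "x \<bullet> (X' *v x) = x \<bullet> (X *v x) - (x \<bullet> column i X)\<^sup>2 / X $ i $ i" for x
    by (simp add: X'_def inner_vec_def matrix_vector_mult_def column_def power2_eq_square
        sum_product sum_distrib_left sum_subtractf[symmetric] sum_divide_distrib algebra_simps)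
  have col: "X *v axis i 1 = column i X"
    by (simp add: matrix_vector_mul_component vec_eq_iff inner_axis column_def)
  have d: "axis i 1 \<bullet> (X *v axis i 1) = X $ i $ i"
    unfolding col by (simp add: inner_axis' column_def)
  have "X $ i $ i > 0"
    using X i d unfolding pos_semidef_def by (metis order_le_less)
  moreover have "(x \<bullet> column i X)\<^sup>2 \<le> (x \<bullet> (X *v x)) * X $ i $ i" for x
    using pos_semidef_Cauchy_Schwarz[OF X, of x "axis i 1", unfolded d] by (simp only: col)
  ultimately have "x \<bullet> (X' *v x) \<ge> 0" for x
    unfolding form by (simp add: field_simps)
  moreover have "transpose X' = X'"
    using sym by (simp add: X'_def transpose_def vec_eq_iff)
  ultimately show ?thesis by (simp add: pos_semidef_def)
qed

text \<open>Cauchy-Schwarz at two unit vectors bounds the square of an entry by the product of the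
  two diagonal entries.\<close>

lemma pos_semidef_zero_diagonal:
  fixes X :: "real ^ 'n ^ 'n"
  assumes "pos_semidef X" and "X $ j $ j = 0"
  shows "X $ i $ j = 0"
proof -
  have e: "axis k 1 \<bullet> (X *v axis l 1) = X $ k $ l" for k l
    by (simp add: matrix_vector_mul_component inner_axis inner_axis')
  show ?thesis
    using pos_semidef_Cauchy_Schwarz[OF assms(1), of "axis i 1" "axis j 1"] assms(2) e by simp
qed

text \<open>Induction on the number of nonzero diagonal entries of \<open>X\<close>: each
  elimination step lowers it, and a zero diagonal forces \<open>X = 0\<close>.\<close>

lemma trace_mult_pos_semidef_nonneg:
  fixes Z X :: "real ^ 'n ^ 'n"
  assumes Z: "\<And>x. x \<bullet> (Z *v x) \<ge> 0" and "pos_semidef X"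
  shows "trace (Z ** X) \<ge> 0"
  using assms(2)
proof (induction "card {i. X $ i $ i \<noteq> 0}" arbitrary: X rule: less_induct)
  case less
  show ?case
  proof (cases "\<exists>i. X $ i $ i \<noteq> 0")
    case False
    then have "X = 0"
      using pos_semidef_zero_diagonal[OF less.prems] by (simp add: vec_eq_iff)
    then show ?thesis by (simp add: trace_def)
  next
    case True
    then obtain i where i: "X $ i $ i \<noteq> 0" by blast
    define X' where "X' = (\<chi> j k. X $ j $ k - X $ j $ i * X $ k $ i / X $ i $ i)"
    have psd: "pos_semidef X'"
      unfolding X'_def by (rule pos_semidef_eliminate[OF less.prems i])
    have sym: "X $ j $ k = X $ k $ j" for j k
      using less.prems unfolding pos_semidef_def by (metis transpose_def vec_lambda_beta)
    \<comment> \<open>Elimination creates no new nonzero diagonal entry: where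
      \<open>X $ j $ j = 0\<close>, the subtracted term contains the factor
      \<open>X $ j $ i = 0\<close>.\<close>
    have "X' $ j $ j = 0" if "X $ j $ j = 0" for j
      using pos_semidef_zero_diagonal[OF less.prems that, of i] that sym[of i j]
      by (simp add: X'_def)
    moreover have "X' $ i $ i = 0"
      using i by (simp add: X'_def)
    ultimately have "{j. X' $ j $ j \<noteq> 0} \<subset> {j. X $ j $ j \<noteq> 0}"
      using i by blast
    then have "trace (Z ** X') \<ge> 0"
      by (intro less.hyps psd psubset_card_mono) simp_all
    moreover have "trace (Z ** X) =
        trace (Z ** X') + (column i X \<bullet> (Z *v column i X)) / X $ i $ i"
      by (simp add: X'_def trace_def matrix_matrix_mult_def matrix_vector_mult_def inner_vec_def
          column_def sum_distrib_left sum_divide_distrib sum.distrib[symmetric] algebra_simps)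
    moreover have "X $ i $ i \<ge> 0"
    proof -
      have "axis i 1 \<bullet> (X *v axis i 1) = X $ i $ i"
        by (simp add: matrix_vector_mul_component inner_axis inner_axis')
      then show ?thesis
        using less.prems unfolding pos_semidef_def by metis
    qed
    ultimately show ?thesis using Z by simp
  qed
qed

text \<open>Substituting \<open>y = M *v z\<close> turns the form of the inverse at \<open>y\<close>
  into the form of \<open>M\<close> at \<open>z\<close>. Invertibility follows from the trivial
  kernel of \<open>M\<close>.\<close>

lemma pos_def_inverse_nonneg:
  fixes M :: "real ^ 'm ^ 'm"
  assumes "pos_def M"
  shows "y \<bullet> (matrix_inv M *v y) \<ge> 0"
proof -
  have "x = 0" if "M *v x = 0" for x
    using assms that unfolding pos_def_def by (metis inner_zero_right less_irrefl)
  then have "invertible M"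
    by (simp add: invertible_left_inverse matrix_left_invertible_ker)
  then have "M ** matrix_inv M = mat 1"
    unfolding invertible_def matrix_inv_def by (rule someI2_ex) blast
  then have "M *v (matrix_inv M *v y) = y"
    by (simp add: matrix_vector_mul_assoc)
  then have "y \<bullet> (matrix_inv M *v y) = (matrix_inv M *v y) \<bullet> (M *v (matrix_inv M *v y))"
    by (simp add: inner_commute)
  also have "\<dots> \<ge> 0"
    using assms unfolding pos_def_def by (metis inner_zero_left order.refl less_imp_le)
  finally show ?thesis .
qed

text \<open>By symmetry of \<open>P\<close>, \<open>Z_mat A B R P\<close> factors as
  \<open>transpose G ** matrix_inv M ** G\<close>. Here \<open>M\<close> is positive definite, as
  \<open>R\<close> adds a strictly positive form to a nonnegative one.\<close>

lemma Z_mat_nonneg: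
  fixes A P :: "real ^ 'n ^ 'n" and B :: "real ^ 'm ^ 'n"
  assumes R: "pos_def R" and P: "pos_def P"
  shows "x \<bullet> (Z_mat A B R P *v x) \<ge> 0"
proof -
  define M where "M = transpose B ** P ** B + R"
  have tP: "transpose P = P" and tR: "transpose R = R"
    using P R by (simp_all add: pos_def_def)
  have P0: "y \<bullet> (P *v y) \<ge> 0" for y
    using P unfolding pos_def_def by (metis inner_zero_left order.refl less_imp_le)
  have "y \<bullet> (M *v y) = (B *v y) \<bullet> (P *v (B *v y)) + y \<bullet> (R *v y)" for y
    by (simp add: M_def matrix_vector_mult_add_rdistrib inner_add_right
        matrix_vector_mul_assoc[symmetric] inner_transpose_mult del: transpose_matrix_vector)
  moreover have "transpose M = transpose (transpose B ** P ** B) + transpose R"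
    by (simp add: M_def transpose_def vec_eq_iff)
  then have "transpose M = M"
    by (simp add: M_def tP tR matrix_transpose_mul matrix_mul_assoc)
  ultimately have M: "pos_def M"
    using P0 R by (simp add: pos_def_def add_nonneg_pos)
  define G where "G = transpose B ** P ** A"
  have "Z_mat A B R P = transpose G ** matrix_inv M ** G"
    by (simp add: Z_mat_def M_def G_def matrix_transpose_mul tP matrix_mul_assoc)
  then have "x \<bullet> (Z_mat A B R P *v x) = (G *v x) \<bullet> (matrix_inv M *v (G *v x))"
    by (simp add: matrix_vector_mul_assoc[symmetric] inner_transpose_mult
        del: transpose_matrix_vector)
  then show ?thesis using pos_def_inverse_nonneg[OF M] by simp
qed

lemma mpow_Suc_right: "mpow A (Suc k) = mpow A k ** A"
  by (induction k) (simp_all add: matrix_mul_assoc)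

lemma transpose_mpow: "transpose (mpow A k) = mpow (transpose A) k"
proof (induction k)
  case (Suc k)
  then show ?case
    by (metis mpow.simps(2) mpow_Suc_right matrix_transpose_mul)
qed (simp add: transpose_mat)

lemma \<beta>_Suc:
  assumes "p \<ge> 1"
  shows "\<beta> A W Z (Suc p) = \<beta> A W Z p + trace (Z ** Y_mat A W p)"
proof -
  \<comment> \<open>The value 0 at \<open>q = 1\<close> agrees with the empty sum, so one formula
    covers every \<open>q\<close>.\<close>
  have *: "\<beta> A W Z q = trace (Z ** (\<Sum>s = 1..q - 1. Y_mat A W s))" for q
    by (simp add: \<beta>_def trace_def)
  obtain k where "p = Suc k" using assms by (cases p) auto
  then show ?thesis
    unfolding * by (simp add: matrix_add_ldistrib trace_add)
qed

theorem theorem1: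
  fixes A Q W P Z :: "real ^ 'n ^ 'n"
    and B :: "real ^ 'm ^ 'n"
    and C\<^sub>2 :: "real ^ 'n ^ 'q"
    and R :: "real ^ 'm ^ 'm"
  assumes "Q = transpose C\<^sub>2 ** C\<^sub>2"
    and "controllable A B"
    and "observable A C\<^sub>2"
    and "pos_def R"
    and "pos_semidef W"
    and "pos_def P" and "riccati_solution A B Q R P"
    and "\<And>P'. pos_def P' \<Longrightarrow> riccati_solution A B Q R P' \<Longrightarrow> P' = P"
    and "Z = Z_mat A B R P"
  shows "\<forall>i::nat. i \<ge> 2 \<longrightarrow> \<beta> A W Z i \<le> (\<beta> A W Z (i + 1) + \<beta> A W Z (i - 1)) / 2"
proof (intro allI impI)
  fix i :: nat
  assume "i \<ge> 2"
  \<comment> \<open>\<open>\<beta>_Suc\<close> is used at \<open>k\<close> and at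
    \<open>Suc k\<close>; the bound \<open>i \<ge> 2\<close> makes the lower use legitimate.\<close>
  then obtain k where i: "i = Suc k" and k: "k \<ge> 1" by (cases i) auto
  let ?X = "mpow A k ** W ** mpow (transpose A) k"
  have "pos_semidef ?X"
    using pos_semidef_congruence[OF assms(5), of "mpow A k"] by (simp add: transpose_mpow)
  then have "trace (Z ** ?X) \<ge> 0"
    using trace_mult_pos_semidef_nonneg Z_mat_nonneg[OF assms(4,6)] assms(9) by metis
  moreover have "trace (Z ** Y_mat A W (Suc k)) = trace (Z ** Y_mat A W k) + trace (Z ** ?X)"
    by (simp add: Y_mat_def matrix_add_ldistrib trace_add)
  ultimately show "\<beta> A W Z i \<le> (\<beta> A W Z (i + 1) + \<beta> A W Z (i - 1)) / 2"
    using \<beta>_Suc[OF k, of A W Z] \<beta>_Suc[of "Suc k" A W Z] by (simp add: i)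
qed

end
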